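(* Let $\mathcal H$ be a separable Hilbert space, $J$ a countable index set, $I=\{1,\dots,m\}$. For each $i\in I$ let $F_i=\{f_{ij}\}_{j\in J}$ be a frame for $\mathcal H$ with bounds $A_i,B_i$. Fix $k\in I$, and for any $\sigma\subset J$ and $i\in I$ with $i\neq k$ let $$P_i^{\sigma}(f)=\sum_{j\in\sigma}\langle f,f_{ij}\rangle f_{ij}-\sum_{j\in\sigma}\langle f,f_{kj}\rangle f_{kj},\qquad f\in\mathcal H.$$ If $P_i^\sigma$ is a positive linear operator for every $\sigma\subset J$ and every $i\ne k$, then the family of frames $\{F_i\}_{i\in I}$ is woven.
   Context: A sequence $\{f_j\}_{j\in J}$ in $\mathcal H$ is a frame for $\mathcal H$ with lower and upper bounds $A,B>0$ if $A\|f\|^2\le\sum_{j\in J}|\langle f,f_j\rangle|^2\le B\|f\|^2$ for all $f\in\mathcal H$. A linear operator $P$ on $\mathcal H$ is positive if $\langle Pf,f\rangle\ge0$ for all $f\in\mathcal H$. A partition $\{\sigma_i\}_{i\in I}$ of $J$ is a family of pairwise disjoint (possibly empty) subsets of $J$ with union $J$. A family of frames $\{F_i=\{f_{ij}\}_{j\in J}\}_{i\in I}$ is woven if there are universal constants $A,B>0$ such that for every partition $\{\sigma_i\}_{i\in I}$ of $J$ the family $\{f_{ij}\}_{j\in\sigma_i,i\in I}$ is a frame for $\mathcal H$ with bounds $A$ and $B$. *)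

theory Defs
  imports "HOL-Analysis.Analysis"
begin

text \<open>
  A Hilbert space may be real or complex. Up to isomorphism the only real normed fields are the
  reals and the complex numbers, and the last axiom below forces \<open>conjugate\<close> to be the identity and
  the complex conjugation, respectively. So this class adds exactly the conjugation to
  \<^class>\<open>real_normed_field\<close>.
\<close>

class real_or_complex = real_normed_field +
  fixes conjugate :: "'a \<Rightarrow> 'a"
  assumes conjugate_add: "conjugate (x + y) = conjugate x + conjugate y"
    and conjugate_mult: "conjugate (x * y) = conjugate x * conjugate y"
    and conjugate_scaleR: "conjugate (scaleR r x) = scaleR r (conjugate x)"
    and mult_conjugate: "x * conjugate x = scaleR ((norm x)\<^sup>2) 1"

instantiation real :: real_or_complex
begin
definition conjugate_real :: "real \<Rightarrow> real" where "conjugate_real x = x"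
instance
  by standard (simp_all add: conjugate_real_def power2_eq_square)
end

instantiation complex :: real_or_complex
begin
definition conjugate_complex :: "complex \<Rightarrow> complex" where "conjugate_complex = cnj"
instance
  by standard (simp_all add: conjugate_complex_def scaleR_conv_of_real flip: complex_norm_square)
end

text \<open>
  Completeness of the space comes from the sort \<^class>\<open>banach\<close>; the last axiom says that the norm is
  the one induced by the inner product, which also makes the inner product positive definite.
\<close>

locale hilbert_space = vector_space scal
  for scal :: "'k::real_or_complex \<Rightarrow> 'h::banach \<Rightarrow> 'h" +
  fixes ip :: "'h \<Rightarrow> 'h \<Rightarrow> 'k"
  assumes scale_of_real: "scal (of_real r) x = r *\<^sub>R x"
    and ip_add_left: "ip (x + y) z = ip x z + ip y z"
    and ip_scale_left: "ip (scal c x) y = c * ip x y"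
    and ip_commute: "ip y x = conjugate (ip x y)"
    and ip_self: "ip x x = of_real ((norm x)\<^sup>2)"

lemma hilbert_space_real_inner:
  "hilbert_space scaleR (inner :: 'h::{real_inner,banach} \<Rightarrow> 'h \<Rightarrow> real)"
  by unfold_locales
    (simp_all add: algebra_simps conjugate_real_def inner_commute power2_norm_eq_inner)

lemma hilbert_space_complex: "hilbert_space (*) (\<lambda>x y :: complex. x * cnj y)"
  by unfold_locales
    (simp_all add: algebra_simps conjugate_complex_def complex_norm_square scaleR_conv_of_real
      flip: of_real_power)

definition frame ::
  "('h \<Rightarrow> 'h \<Rightarrow> 'k::real_or_complex) \<Rightarrow> 'j set \<Rightarrow> ('j \<Rightarrow> 'h::banach) \<Rightarrow> real \<Rightarrow> real \<Rightarrow> bool"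
where
  "frame ip J g A B \<longleftrightarrow> A > 0 \<and> B > 0 \<and>
     (\<forall>f. (\<lambda>j. (norm (ip f (g j)))\<^sup>2) summable_on J \<and>
          A * (norm f)\<^sup>2 \<le> (\<Sum>\<^sub>\<infinity>j\<in>J. (norm (ip f (g j)))\<^sup>2) \<and>
          (\<Sum>\<^sub>\<infinity>j\<in>J. (norm (ip f (g j)))\<^sup>2) \<le> B * (norm f)\<^sup>2)"

text \<open>
  In the complex case the condition below includes that \<open>ip (P f) f\<close> is real.
\<close>

definition positive_linear_operator ::
  "('k::real_or_complex \<Rightarrow> 'h::banach \<Rightarrow> 'h) \<Rightarrow> ('h \<Rightarrow> 'h \<Rightarrow> 'k) \<Rightarrow> ('h \<Rightarrow> 'h) \<Rightarrow> bool"
where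
  "positive_linear_operator scal ip P \<longleftrightarrow>
     Vector_Spaces.linear scal scal P \<and> (\<forall>f. ip (P f) f \<in> \<real>\<^sub>\<ge>\<^sub>0)"

text \<open>
  Unlike \<^const>\<open>partition_on\<close>, an indexed partition may have empty blocks.
\<close>

definition indexed_partition :: "'i set \<Rightarrow> 'j set \<Rightarrow> ('i \<Rightarrow> 'j set) \<Rightarrow> bool" where
  "indexed_partition I J \<sigma> \<longleftrightarrow> disjoint_family_on \<sigma> I \<and> (\<Union>i\<in>I. \<sigma> i) = J"

definition woven ::
  "('h \<Rightarrow> 'h \<Rightarrow> 'k::real_or_complex) \<Rightarrow> 'i set \<Rightarrow> 'j set \<Rightarrow> ('i \<Rightarrow> 'j \<Rightarrow> 'h::banach) \<Rightarrow> bool"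
where
  "woven ip I J F \<longleftrightarrow>
     (\<exists>A>0. \<exists>B>0. \<forall>\<sigma>. indexed_partition I J \<sigma> \<longrightarrow>
        frame ip (SIGMA i:I. \<sigma> i) (\<lambda>(i, j). F i j) A B)"

text \<open>
  The sums in the operator are unconditional sums in the norm of the space. They converge
  whenever \<open>\<sigma> \<subseteq> J\<close> and \<open>F i\<close>, \<open>F k\<close> are frames indexed by \<open>J\<close>, so the value \<open>0\<close> that
  \<^const>\<open>infsum\<close> assigns to a divergent sum plays no role.
\<close>

definition frame_operator_diff ::
  "('k::real_or_complex \<Rightarrow> 'h::banach \<Rightarrow> 'h) \<Rightarrow> ('h \<Rightarrow> 'h \<Rightarrow> 'k) \<Rightarrow>
    ('i \<Rightarrow> 'j \<Rightarrow> 'h) \<Rightarrow> 'i \<Rightarrow> 'i \<Rightarrow> 'j set \<Rightarrow> 'h \<Rightarrow> 'h"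
where
  "frame_operator_diff scal ip F k i \<sigma> f =
     (\<Sum>\<^sub>\<infinity>j\<in>\<sigma>. scal (ip f (F i j)) (F i j)) - (\<Sum>\<^sub>\<infinity>j\<in>\<sigma>. scal (ip f (F k j)) (F k j))"

end

theory Submission
  imports Defs
begin

text \<open>
  Only the singletons \<open>\<sigma> = {j}\<close> in the positivity hypothesis matter: there it reads
  \<open>|\<langle>f, f\<^sub>k\<^sub>j\<rangle>| \<le> |\<langle>f, f\<^sub>i\<^sub>j\<rangle>|\<close>. A partition of \<open>J\<close> amounts to a choice of an index \<open>c j\<close> for every
  \<open>j\<close>, and \<open>|\<langle>f, f\<^sub>c\<^sub>j\<^sub>,\<^sub>j\<rangle>|\<^sup>2\<close> lies between \<open>|\<langle>f, f\<^sub>k\<^sub>j\<rangle>|\<^sup>2\<close> and the sum of \<open>|\<langle>f, f\<^sub>i\<^sub>j\<rangle>|\<^sup>2\<close> over all \<open>i\<close>.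
  So \<open>A\<^sub>k\<close> and the sum of the \<open>B\<^sub>i\<close> are universal bounds.
\<close>

context hilbert_space
begin

lemma ip_diff_left: "ip (x - y) z = ip x z - ip y z"
  using ip_add_left[of "x - y" y z] by simp

text \<open>With \<open>c = ip f g\<close>, linearity gives \<open>c * ip g f\<close>, and
  \<open>ip g f\<close> is the conjugate of \<open>c\<close>.\<close>

lemma ip_rank_one: "ip (scal (ip f g) g) f = of_real ((norm (ip f g))\<^sup>2)"
  by (metis ip_scale_left ip_commute mult_conjugate scaleR_conv_of_real mult.right_neutral)

text \<open>Over \<open>{j}\<close> both sums collapse to one rank-one term, so positivity at
  \<open>f\<close> is a comparison of two squared coefficients.\<close>

lemma norm_ip_le_if_positive_singleton:
  assumes "positive_linear_operator scal ip (frame_operator_diff scal ip F k i {j})"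
  shows "norm (ip f (F k j)) \<le> norm (ip f (F i j))"
proof -
  have "ip (frame_operator_diff scal ip F k i {j} f) f \<in> \<real>\<^sub>\<ge>\<^sub>0"
    using assms by (simp add: positive_linear_operator_def)
  then have "(of_real ((norm (ip f (F i j)))\<^sup>2 - (norm (ip f (F k j)))\<^sup>2) :: 'k) \<in> \<real>\<^sub>\<ge>\<^sub>0"
    by (simp add: frame_operator_diff_def ip_diff_left ip_rank_one)
  then have "(norm (ip f (F k j)))\<^sup>2 \<le> (norm (ip f (F i j)))\<^sup>2"
    by (simp only: nonneg_Reals_of_real_iff)
  then show ?thesis
    by (rule power2_le_imp_le) simp
qed

end

text \<open>Covering provides \<open>c\<close>, and disjointness makes \<open>c j\<close> the only
  block index of \<open>j\<close>. The bijection lets sums over the blocks be taken over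
  \<open>J\<close>.\<close>

lemma indexed_partition_choice:
  assumes "indexed_partition I J \<sigma>"
  obtains c where "\<And>j. j \<in> J \<Longrightarrow> c j \<in> I"
    and "bij_betw (\<lambda>j. (c j, j)) J (SIGMA i:I. \<sigma> i)"
proof -
  have "\<forall>j\<in>J. \<exists>i\<in>I. j \<in> \<sigma> i"
    using assms by (auto simp: indexed_partition_def)
  then obtain c where c: "\<And>j. j \<in> J \<Longrightarrow> c j \<in> I \<and> j \<in> \<sigma> (c j)"
    by metis
  have "(i, j) \<in> (\<lambda>j. (c j, j)) ` J" if "i \<in> I" "j \<in> \<sigma> i" for i j
  proof -
    have j: "j \<in> J"
      using assms that by (auto simp: indexed_partition_def)
    have "c j = i"
      using assms that c[OF j] by (auto simp: indexed_partition_def disjoint_family_on_def)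
    then show ?thesis
      using j by blast
  qed
  then have "(\<lambda>j. (c j, j)) ` J = (SIGMA i:I. \<sigma> i)"
    using c by auto
  then have "bij_betw (\<lambda>j. (c j, j)) J (SIGMA i:I. \<sigma> i)"
    by (simp add: bij_betw_def inj_on_def)
  then show ?thesis
    using that c by blast
qed

lemma has_sum_sum:
  fixes g :: "'i \<Rightarrow> 'j \<Rightarrow> 'a::topological_comm_monoid_add"
  assumes "\<And>i. i \<in> I \<Longrightarrow> (g i has_sum s i) J"
  shows "((\<lambda>j. \<Sum>i\<in>I. g i j) has_sum (\<Sum>i\<in>I. s i)) J"
  \<comment> \<open>For infinite \<open>I\<close> both finite sums are 0 by convention.\<close>
  using assms by (induction I rule: infinite_finite_induct) (auto intro!: has_sum_add)

lemma woven_if_pointwise_minimal: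
  assumes "finite I" and "k \<in> I"
    and frames: "\<And>i. i \<in> I \<Longrightarrow> frame ip J (F i) (A i) (B i)"
    and minimal: "\<And>i j f. i \<in> I \<Longrightarrow> j \<in> J \<Longrightarrow> norm (ip f (F k j)) \<le> norm (ip f (F i j))"
  shows "woven ip I J F"
proof -
  have "frame ip (SIGMA i:I. \<sigma> i) (\<lambda>(i, j). F i j) (A k) (sum B I)"
    if \<sigma>: "indexed_partition I J \<sigma>" for \<sigma>
  proof -
    obtain c where c: "\<And>j. j \<in> J \<Longrightarrow> c j \<in> I"
      and bij: "bij_betw (\<lambda>j. (c j, j)) J (SIGMA i:I. \<sigma> i)"
      using indexed_partition_choice[OF \<sigma>] by blast
    have "(\<lambda>(i, j). (norm (ip f (F i j)))\<^sup>2) summable_on (SIGMA i:I. \<sigma> i) \<and>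
        A k * (norm f)\<^sup>2 \<le> (\<Sum>\<^sub>\<infinity>(i, j)\<in>(SIGMA i:I. \<sigma> i). (norm (ip f (F i j)))\<^sup>2) \<and>
        (\<Sum>\<^sub>\<infinity>(i, j)\<in>(SIGMA i:I. \<sigma> i). (norm (ip f (F i j)))\<^sup>2) \<le> sum B I * (norm f)\<^sup>2" for f
    proof -
      define g where "g i j = (norm (ip f (F i j)))\<^sup>2" for i j
      have g: "g i summable_on J" "A i * (norm f)\<^sup>2 \<le> infsum (g i) J"
        "infsum (g i) J \<le> B i * (norm f)\<^sup>2" if "i \<in> I" for i
        using frames[OF that] by (auto simp: frame_def g_def[abs_def])
      have le_sum: "g (c j) j \<le> (\<Sum>i\<in>I. g i j)" if "j \<in> J" for j
        using c[OF that] \<open>finite I\<close> by (intro member_le_sum) (auto simp: g_def)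
      have has_sum: "((\<lambda>j. \<Sum>i\<in>I. g i j) has_sum (\<Sum>i\<in>I. infsum (g i) J)) J"
        using g by (intro has_sum_sum) auto
      then have sum: "(\<lambda>j. \<Sum>i\<in>I. g i j) summable_on J"
        by (rule has_sum_imp_summable)
      have summable: "(\<lambda>j. g (c j) j) summable_on J"
        \<comment> \<open>The dominating series converges, being a finite sum of the convergent
          series \<open>g i\<close>.\<close>
        by (rule summable_on_comparison_test[OF sum]) (auto simp: le_sum, auto simp: g_def)
      have "A k * (norm f)\<^sup>2 \<le> infsum (g k) J"
        using g \<open>k \<in> I\<close> by blast
      also have "\<dots> \<le> (\<Sum>\<^sub>\<infinity>j\<in>J. g (c j) j)"
        using g \<open>k \<in> I\<close> minimal c by (intro infsum_mono summable) (auto simp: g_def)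
      finally have lower: "A k * (norm f)\<^sup>2 \<le> (\<Sum>\<^sub>\<infinity>j\<in>J. g (c j) j)" .
      have "(\<Sum>\<^sub>\<infinity>j\<in>J. g (c j) j) \<le> (\<Sum>\<^sub>\<infinity>j\<in>J. \<Sum>i\<in>I. g i j)"
        by (intro infsum_mono summable sum le_sum)
      also have "\<dots> = (\<Sum>i\<in>I. infsum (g i) J)"
        using has_sum by (rule infsumI)
      also have "\<dots> \<le> (\<Sum>i\<in>I. B i * (norm f)\<^sup>2)"
        by (intro sum_mono g)
      finally have "(\<Sum>\<^sub>\<infinity>j\<in>J. g (c j) j) \<le> sum B I * (norm f)\<^sup>2"
        by (simp add: sum_distrib_right)
      \<comment> \<open>Reindexing along \<open>j \<mapsto> (c j, j)\<close> carries the bounds from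
        \<open>J\<close> back to the disjoint union of the blocks.\<close>
      with summable lower show ?thesis
        using summable_on_reindex_bij_betw[OF bij, of "\<lambda>(i, j). g i j"]
          infsum_reindex_bij_betw[OF bij, of "\<lambda>(i, j). g i j"]
        by (simp add: g_def)
    qed
    \<comment> \<open>The sum of the \<open>B i\<close> is positive because \<open>I\<close>
      contains \<open>k\<close> and so is nonempty.\<close>
    moreover have "A k > 0" "sum B I > 0"
      using frames \<open>finite I\<close> \<open>k \<in> I\<close> by (auto simp: frame_def intro!: sum_pos)
    ultimately show ?thesis
      by (simp add: frame_def case_prod_unfold)
  qed
  moreover have "A k > 0" "sum B I > 0"
    using frames \<open>finite I\<close> \<open>k \<in> I\<close> by (auto simp: frame_def intro!: sum_pos)
  ultimately show ?thesis
    unfolding woven_def by blast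
qed

theorem theorem2p9:
  fixes scal :: "'k::real_or_complex \<Rightarrow> 'h::banach \<Rightarrow> 'h"
    and ip :: "'h \<Rightarrow> 'h \<Rightarrow> 'k"
    and J :: "'j set" and m k :: nat
    and F :: "nat \<Rightarrow> 'j \<Rightarrow> 'h" and A B :: "nat \<Rightarrow> real"
  assumes "hilbert_space scal ip"
    and "separable_space (euclidean :: 'h topology)"
    and "countable J"
    and "\<And>i. i \<in> {1..m} \<Longrightarrow> frame ip J (F i) (A i) (B i)"
    and "k \<in> {1..m}"
    and "\<And>\<sigma> i. \<sigma> \<subseteq> J \<Longrightarrow> i \<in> {1..m} \<Longrightarrow> i \<noteq> k \<Longrightarrow>
           positive_linear_operator scal ip (frame_operator_diff scal ip F k i \<sigma>)"
  shows "woven ip {1..m} J F"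
proof (rule woven_if_pointwise_minimal[OF _ assms(5,4)])
  interpret hilbert_space scal ip
    by (fact assms(1))
  show "norm (ip f (F k j)) \<le> norm (ip f (F i j))" if "i \<in> {1..m}" "j \<in> J" for i j f
  \<comment> \<open>Positivity is given for \<open>i \<noteq> k\<close> and applies to
    \<open>{j}\<close>, a subset of \<open>J\<close>; for \<open>i = k\<close> the inequality is
    reflexivity.\<close>
  proof (cases "i = k")
    case False
    with that show ?thesis
      by (intro norm_ip_le_if_positive_singleton assms(6)) auto
  qed simp
qed simp_all

end
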